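(* Let $X$ be a Banach space and $\phi:[0,1]\to X$ a McShane integrable function. Then $\phi$ is Pettis integrable.
   Context: Banach spaces are real; $X^*$ is the dual of $X$. $\mu$ is Lebesgue measure on $[0,1]$ and $\Sigma$ the $\sigma$-algebra of Lebesgue measurable subsets of $[0,1]$. Intervals are non-overlapping if their interiors are pairwise disjoint. McShane integral: A McShane partition of $[0,1]$ is a finite sequence $\langle([a_i,b_i],t_i)\rangle_{i\le n}$ such that $\langle[a_i,b_i]\rangle_{i\le n}$ is a non-overlapping family of closed intervals covering $[0,1]$ (i.e. with union $[0,1]$) and $t_i\in[0,1]$ for each $i$ (it is not required that $t_i\in[a_i,b_i]$). A gauge on $[0,1]$ is a function $\delta:[0,1]\to(0,\infty)$. The partition is subordinate to $\delta$ if $t_i-\delta(t_i)\le a_i\le b_i\le t_i+\delta(t_i)$ for every $i\le n$. A function $\phi:[0,1]\to X$ is McShane integrable, with McShane integral $w\in X$, if for every $\epsilon>0$ there is a gauge $\delta$ such that $\|w-\sum_{i\le n}(b_i-a_i)\phi(t_i)\|\le\epsilon$ for every McShane partition $\langle([a_i,b_i],t_i)\rangle_{i\le n}$ of $[0,1]$ subordinate to $\delta$. Pettis integral: $\phi:[0,1]\to X$ is Pettis integrable if for every $E\in\Sigma$ there is $w_E\in X$ such that for every $f\in X^*$ the integral $\int_E f(\phi(x))\,\mu(dx)$ exists and equals $f(w_E)$. *)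

theory Defs
  imports "HOL-Analysis.Analysis"
begin

(* An element (a, b, t) of the list stands for the pair ([a,b], t).  The intervals may be
   degenerate, and the tag t need not lie in [a,b]. *)
definition mcshane_partition :: "(real \<times> real \<times> real) list \<Rightarrow> bool" where
  "mcshane_partition p \<longleftrightarrow>
     (\<forall>(a, b, t) \<in> set p. a \<le> b \<and> t \<in> {0..1}) \<and>
     (\<forall>i < length p. \<forall>j < length p. i \<noteq> j \<longrightarrow>
        (case (p ! i, p ! j) of ((a, b, _), (c, d, _)) \<Rightarrow>
           interior {a..b} \<inter> interior {c..d} = {})) \<and>
     (\<Union>(a, b, t) \<in> set p. {a..b}) = {0..1}"

(* Only the restriction of the function to [0,1] matters.  The name avoids the library
   constant gauge, which is a neighbourhood assignment on a whole space. *)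
definition mcshane_gauge :: "(real \<Rightarrow> real) \<Rightarrow> bool" where
  "mcshane_gauge \<delta> \<longleftrightarrow> (\<forall>t \<in> {0..1}. 0 < \<delta> t)"

definition subordinate :: "(real \<Rightarrow> real) \<Rightarrow> (real \<times> real \<times> real) list \<Rightarrow> bool" where
  "subordinate \<delta> p \<longleftrightarrow> (\<forall>(a, b, t) \<in> set p. t - \<delta> t \<le> a \<and> a \<le> b \<and> b \<le> t + \<delta> t)"

definition has_mcshane_integral :: "(real \<Rightarrow> 'a::banach) \<Rightarrow> 'a \<Rightarrow> bool" where
  "has_mcshane_integral \<phi> w \<longleftrightarrow>
     (\<forall>\<epsilon> > 0. \<exists>\<delta>. mcshane_gauge \<delta> \<and>
        (\<forall>p. mcshane_partition p \<and> subordinate \<delta> p \<longrightarrow>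
           norm (w - (\<Sum>(a, b, t) \<leftarrow> p. (b - a) *\<^sub>R \<phi> t)) \<le> \<epsilon>))"

definition mcshane_integrable :: "(real \<Rightarrow> 'a::banach) \<Rightarrow> bool" where
  "mcshane_integrable \<phi> \<longleftrightarrow> (\<exists>w. has_mcshane_integral \<phi> w)"

definition pettis_integrable :: "(real \<Rightarrow> 'a::banach) \<Rightarrow> bool" where
  "pettis_integrable \<phi> \<longleftrightarrow>
     (\<forall>E \<in> sets (lebesgue_on {0..1}). \<exists>w. \<forall>f :: 'a \<Rightarrow>\<^sub>L real.
        set_integrable (lebesgue_on {0..1}) E (\<lambda>x. blinfun_apply f (\<phi> x)) \<and>
        (LINT x:E|lebesgue_on {0..1}. blinfun_apply f (\<phi> x)) = blinfun_apply f w)"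

end

theory Submission
  imports Defs
begin

text \<open>Tags of a subordinate McShane partition may be exchanged freely, so two subordinate tag systems
  on the same intervals satisfy \<open>\<parallel>\<Sum> c i (\<phi> (s i) - \<phi> (t i))\<parallel> \<le> 2\<epsilon>\<close> for all
  \<open>0 \<le> c i \<le> u i - l i\<close>. With \<open>c\<close> the measures of common refinements intersected with \<open>E\<close>, the sums
  \<open>\<Sum> \<mu>(K \<inter> E) \<phi>(x)\<close> over ever finer tagged divisions are Cauchy in norm, so they have a limit \<open>w\<close>,
  without any appeal to the Hahn--Banach theorem. For \<open>g = f \<circ> \<phi>\<close> the same bound shows that \<open>g\<close> and \<open>\<bar>g\<bar>\<close>
  are Henstock--Kurzweil integrable, and that \<open>\<Sum> \<integral>\<^sub>K \<bar>g - g x\<bar> \<le> 4\<epsilon>\<close>, which identifies \<open>f w\<close>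
  as \<open>\<integral>\<^sub>E g\<close>.\<close>

section \<open>McShane approximations at a fixed gauge, and the exchange of tags\<close>

definition mcshane_approx :: "(real \<Rightarrow> real) \<Rightarrow> real \<Rightarrow> (real \<Rightarrow> 'a::banach) \<Rightarrow> 'a \<Rightarrow> bool" where
  "mcshane_approx \<delta> \<epsilon> \<phi> w \<longleftrightarrow>
     (\<forall>p. mcshane_partition p \<and> subordinate \<delta> p \<longrightarrow>
        norm (w - (\<Sum>(a, b, t) \<leftarrow> p. (b - a) *\<^sub>R \<phi> t)) \<le> \<epsilon>)"

lemma has_mcshane_integralE:
  assumes "has_mcshane_integral \<phi> w" "0 < e"
  obtains \<delta> where "mcshane_gauge \<delta>" "mcshane_approx \<delta> e \<phi> w"
  using assms unfolding has_mcshane_integral_def mcshane_approx_def by metis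

text \<open>A functional acts termwise on McShane sums, so the gauge stays the same and only the
  error is scaled. Keeping the gauge matters later: gauges and divisions are fixed for \<phi> before
  any functional is chosen.\<close>

lemma mcshane_approx_blinfun:
  fixes f :: "'a::banach \<Rightarrow>\<^sub>L real"
  assumes "mcshane_approx \<delta> \<epsilon> \<phi> w"
  shows "mcshane_approx \<delta> (norm f * \<epsilon>) (\<lambda>x. f (\<phi> x)) (f w)"
  unfolding mcshane_approx_def
proof (intro allI impI)
  fix p assume p: "mcshane_partition p \<and> subordinate \<delta> p"
  have "f (\<Sum>(a, b, t) \<leftarrow> p. (b - a) *\<^sub>R \<phi> t) = (\<Sum>(a, b, t) \<leftarrow> p. (b - a) *\<^sub>R f (\<phi> t))"
    by (induction p) (auto simp: blinfun.add_right blinfun.scaleR_right)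
  then have "f w - (\<Sum>(a, b, t) \<leftarrow> p. (b - a) *\<^sub>R f (\<phi> t))
      = f (w - (\<Sum>(a, b, t) \<leftarrow> p. (b - a) *\<^sub>R \<phi> t))"
    by (simp add: blinfun.diff_right)
  also have "norm \<dots> \<le> norm f * norm (w - (\<Sum>(a, b, t) \<leftarrow> p. (b - a) *\<^sub>R \<phi> t))"
    by (rule norm_blinfun)
  also have "\<dots> \<le> norm f * \<epsilon>"
    using assms p by (intro mult_left_mono) (auto simp: mcshane_approx_def)
  finally show "norm (f w - (\<Sum>(a, b, t) \<leftarrow> p. (b - a) *\<^sub>R f (\<phi> t))) \<le> norm f * \<epsilon>" .
qed

definition subordinate_tag :: "(real \<Rightarrow> real) \<Rightarrow> real \<Rightarrow> real \<Rightarrow> real \<Rightarrow> bool" where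
  "subordinate_tag \<delta> a b t \<longleftrightarrow> t \<in> {0..1} \<and> t - \<delta> t \<le> a \<and> b \<le> t + \<delta> t"

text \<open>Passes from lists to finite indexed families by enumerating \<open>A\<close> without
  repetition. Indices, rather than a set of triples, keep apart degenerate intervals that coincide
  together with their tags.\<close>

lemma mcshane_approx_family:
  assumes "mcshane_approx \<delta> \<epsilon> \<phi> w" and "finite A"
    and le: "\<And>i. i \<in> A \<Longrightarrow> l i \<le> u i"
    and tag: "\<And>i. i \<in> A \<Longrightarrow> subordinate_tag \<delta> (l i) (u i) (t i)"
    and disj: "\<And>i j. i \<in> A \<Longrightarrow> j \<in> A \<Longrightarrow> i \<noteq> j \<Longrightarrow>
      interior {l i..u i} \<inter> interior {l j..u j} = {}"
    and Un: "(\<Union>i\<in>A. {l i..u i}) = {0..1}"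
  shows "norm (w - (\<Sum>i\<in>A. (u i - l i) *\<^sub>R \<phi> (t i))) \<le> \<epsilon>"
proof -
  obtain xs where xs: "set xs = A" "distinct xs"
    using \<open>finite A\<close> finite_distinct_list by blast
  define p where "p = map (\<lambda>i. (l i, u i, t i)) xs"
  have "mcshane_partition p"
    unfolding mcshane_partition_def
  proof (intro conjI allI impI)
    show "\<forall>(a, b, t)\<in>set p. a \<le> b \<and> t \<in> {0..1}"
      using le tag by (auto simp: p_def xs subordinate_tag_def)
    show "(\<Union>(a, b, t)\<in>set p. {a..b}) = {0..1}"
      using Un by (simp add: p_def xs)
  next
    fix i j assume ij: "i < length p" "j < length p" "i \<noteq> j"
    then have "xs ! i \<noteq> xs ! j" "xs ! i \<in> A" "xs ! j \<in> A"
      using xs nth_eq_iff_index_eq[OF xs(2)] by (auto simp: p_def)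
    then show "case (p ! i, p ! j) of ((a, b, _), (c, d, _)) \<Rightarrow> interior {a..b} \<inter> interior {c..d} = {}"
      using disj[of "xs ! i" "xs ! j"] ij by (simp add: p_def)
  qed
  moreover have "subordinate \<delta> p"
    using le tag by (auto simp: p_def xs subordinate_def subordinate_tag_def)
  moreover have "(\<Sum>(a, b, t) \<leftarrow> p. (b - a) *\<^sub>R \<phi> t) = (\<Sum>i\<in>A. (u i - l i) *\<^sub>R \<phi> (t i))"
    using sum_list_distinct_conv_sum_set[OF xs(2), of "\<lambda>i. (u i - l i) *\<^sub>R \<phi> (t i)"] xs
    by (simp add: p_def o_def)
  ultimately show ?thesis
    using assms(1)[unfolded mcshane_approx_def, rule_format, of p] by simp
qed

text \<open>Cut each interval at \<open>l i + c i\<close> and use the tag \<open>s i\<close> on the left part only; the resulting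
  McShane sum differs from the one with all tags \<open>t i\<close> exactly by the sum below.\<close>

lemma mcshane_approx_swap:
  fixes A :: "'i set"
  assumes appr: "mcshane_approx \<delta> \<epsilon> \<phi> w" and "finite A"
    and le: "\<And>i. i \<in> A \<Longrightarrow> l i \<le> u i"
    and s: "\<And>i. i \<in> A \<Longrightarrow> subordinate_tag \<delta> (l i) (u i) (s i)"
    and t: "\<And>i. i \<in> A \<Longrightarrow> subordinate_tag \<delta> (l i) (u i) (t i)"
    and disj: "\<And>i j. i \<in> A \<Longrightarrow> j \<in> A \<Longrightarrow> i \<noteq> j \<Longrightarrow>
      interior {l i..u i} \<inter> interior {l j..u j} = {}"
    and Un: "(\<Union>i\<in>A. {l i..u i}) = {0..1}"
    and c: "\<And>i. i \<in> A \<Longrightarrow> 0 \<le> c i \<and> c i \<le> u i - l i"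
  shows "norm (\<Sum>i\<in>A. c i *\<^sub>R (\<phi> (s i) - \<phi> (t i))) \<le> 2 * \<epsilon>"
proof -
  define l' where "l' = (\<lambda>(i, b). if b then l i else l i + c i)"
  define u' where "u' = (\<lambda>(i, b). if b then l i + c i else u i)"
  define t' where "t' = (\<lambda>(i, b). if b then s i else t i)"
  let ?A = "A \<times> (UNIV :: bool set)"
  have sub: "{l' z..u' z} \<subseteq> {l (fst z)..u (fst z)}" if "z \<in> ?A" for z
    using that c by (force simp: l'_def u'_def split: if_splits)
  have 1: "norm (w - (\<Sum>z\<in>?A. (u' z - l' z) *\<^sub>R \<phi> (t' z))) \<le> \<epsilon>"
  proof (rule mcshane_approx_family[OF appr])
    show "finite ?A" using \<open>finite A\<close> by simp
    show "l' z \<le> u' z" if "z \<in> ?A" for z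
      using that c by (force simp: l'_def u'_def)
    show "subordinate_tag \<delta> (l' z) (u' z) (t' z)" if "z \<in> ?A" for z
      using that c s t by (fastforce simp: l'_def u'_def t'_def subordinate_tag_def)
    show "interior {l' z..u' z} \<inter> interior {l' z'..u' z'} = {}"
      if "z \<in> ?A" "z' \<in> ?A" "z \<noteq> z'" for z z'
    proof (cases "fst z = fst z'")
      case True
      then show ?thesis
        using that by (cases z; cases z') (auto simp: l'_def u'_def split: if_splits)
    next
      case False
      have "interior {l (fst z)..u (fst z)} \<inter> interior {l (fst z')..u (fst z')} = {}"
        using that False by (intro disj) auto
      then show ?thesis
        using interior_mono[OF sub[OF that(1)]] interior_mono[OF sub[OF that(2)]] by blast
    qed
    have split: "{l i..l i + c i} \<union> {l i + c i..u i} = {l i..u i}" if "i \<in> A" for i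
      using c[OF that] by (intro ivl_disj_un_two_touch) auto
    have "(\<Union>z\<in>?A. {l' z..u' z}) = (\<Union>i\<in>A. \<Union>b. {l' (i, b)..u' (i, b)})"
      by blast
    also have "\<dots> = (\<Union>i\<in>A. {l i..l i + c i} \<union> {l i + c i..u i})"
      by (simp add: l'_def u'_def UNIV_bool Un_commute)
    also have "\<dots> = (\<Union>i\<in>A. {l i..u i})"
      by (intro SUP_cong refl split)
    finally show "(\<Union>z\<in>?A. {l' z..u' z}) = {0..1}" using Un by simp
  qed
  have 2: "norm (w - (\<Sum>i\<in>A. (u i - l i) *\<^sub>R \<phi> (t i))) \<le> \<epsilon>"
    by (rule mcshane_approx_family[OF appr \<open>finite A\<close> le t disj Un])
  have "(\<Sum>z\<in>?A. (u' z - l' z) *\<^sub>R \<phi> (t' z))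
      = (\<Sum>i\<in>A. c i *\<^sub>R \<phi> (s i) + (u i - l i - c i) *\<^sub>R \<phi> (t i))"
    unfolding sum.cartesian_product' by (simp add: UNIV_bool l'_def u'_def t'_def algebra_simps)
  then have eq: "(\<Sum>i\<in>A. c i *\<^sub>R (\<phi> (s i) - \<phi> (t i)))
      = (w - (\<Sum>i\<in>A. (u i - l i) *\<^sub>R \<phi> (t i))) - (w - (\<Sum>z\<in>?A. (u' z - l' z) *\<^sub>R \<phi> (t' z)))"
    by (simp add: sum.distrib sum_subtractf algebra_simps)
  show ?thesis
    unfolding eq using norm_triangle_ineq4[of "w - (\<Sum>i\<in>A. (u i - l i) *\<^sub>R \<phi> (t i))"
        "w - (\<Sum>z\<in>?A. (u' z - l' z) *\<^sub>R \<phi> (t' z))"] 1 2 by linarith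
qed

text \<open>Split the indices by the sign of \<open>g (s i) - g (t i)\<close>. Swapping tags over
  the full length for one sign and over length 0 for the other costs at most
  \<open>2 * \<epsilon>\<close>, and the two signs together give the absolute values.\<close>

lemma mcshane_approx_swap_abs:
  fixes A :: "'i set" and g :: "real \<Rightarrow> real"
  assumes "mcshane_approx \<delta> \<epsilon> g w" and "finite A"
    and le: "\<And>i. i \<in> A \<Longrightarrow> l i \<le> u i"
    and "\<And>i. i \<in> A \<Longrightarrow> subordinate_tag \<delta> (l i) (u i) (s i)"
    and "\<And>i. i \<in> A \<Longrightarrow> subordinate_tag \<delta> (l i) (u i) (t i)"
    and "\<And>i j. i \<in> A \<Longrightarrow> j \<in> A \<Longrightarrow> i \<noteq> j \<Longrightarrow>
      interior {l i..u i} \<inter> interior {l j..u j} = {}"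
    and "(\<Union>i\<in>A. {l i..u i}) = {0..1}"
  shows "(\<Sum>i\<in>A. (u i - l i) * \<bar>g (s i) - g (t i)\<bar>) \<le> 4 * \<epsilon>"
proof -
  define c where "c = (\<lambda>P i. if P (g (s i) - g (t i)) then u i - l i else 0)"
  have b: "norm (\<Sum>i\<in>A. c P i *\<^sub>R (g (s i) - g (t i))) \<le> 2 * \<epsilon>" for P
    by (rule mcshane_approx_swap[OF assms]) (auto simp: c_def le)
  have "(\<Sum>i\<in>A. (u i - l i) * \<bar>g (s i) - g (t i)\<bar>)
      = (\<Sum>i\<in>A. c (\<lambda>x. x \<ge> 0) i *\<^sub>R (g (s i) - g (t i))) - (\<Sum>i\<in>A. c (\<lambda>x. x < 0) i *\<^sub>R (g (s i) - g (t i)))"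
    unfolding sum_subtractf[symmetric] by (intro sum.cong) (auto simp: c_def algebra_simps)
  then show ?thesis using b[of "\<lambda>x. x \<ge> 0"] b[of "\<lambda>x. x < 0"] by (simp add: abs_le_iff)
qed

section \<open>Tagged divisions fine for a McShane gauge, and their common refinements\<close>

text \<open>The library notion \<open>gauge\<close> asks for a neighbourhood of every real, whereas
  \<delta> is known to be positive only on the unit interval; hence the arbitrary radius 1
  elsewhere.\<close>

definition gauge_balls :: "(real \<Rightarrow> real) \<Rightarrow> real \<Rightarrow> real set" where
  "gauge_balls \<delta> x = ball x (if x \<in> {0..1} then \<delta> x else 1)"

lemma gauge_gauge_balls: "mcshane_gauge \<delta> \<Longrightarrow> gauge (gauge_balls \<delta>)"
  by (auto simp: gauge_def gauge_balls_def mcshane_gauge_def)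

text \<open>All of \<open>K\<close> lies in the ball around its tag, so the tag serves every
  subinterval of \<open>K\<close> as well. This is what allows the pieces of a refinement to keep
  the tags of the coarser divisions.\<close>

lemma subordinate_tag_gauge_balls:
  assumes "p tagged_division_of S" "gauge_balls \<delta> fine p" "(x, K) \<in> p" "a \<in> K" "b \<in> K" "S \<subseteq> {0..1}"
  shows "subordinate_tag \<delta> a b x"
proof -
  have x: "x \<in> {0..1}" using tagged_division_ofD(2,3)[OF assms(1,3)] assms(6) by blast
  have "K \<subseteq> ball x (\<delta> x)" using assms(2,3) x unfolding fine_def gauge_balls_def by fastforce
  with assms(4,5) have "dist x a < \<delta> x" "dist x b < \<delta> x" by auto
  then show ?thesis using x by (auto simp: subordinate_tag_def dist_real_def)
qed

lemma tagged_division_interval: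
  fixes p :: "(real \<times> real set) set"
  assumes "p tagged_division_of S" "(x, K) \<in> p"
  obtains a b where "K = {a..b}" "a \<le> b"
  using tagged_division_ofD(2,4)[OF assms] by fastforce

lemma tagged_division_inter_interval:
  fixes p q :: "(real \<times> real set) set"
  assumes "p tagged_division_of S" "(x, K) \<in> p" "q tagged_division_of T" "(y, L) \<in> q" "K \<inter> L \<noteq> {}"
  shows "{Inf (K \<inter> L)..Sup (K \<inter> L)} = K \<inter> L" "Inf (K \<inter> L) \<le> Sup (K \<inter> L)"
    "measure lebesgue (K \<inter> L) = Sup (K \<inter> L) - Inf (K \<inter> L)"
proof -
  obtain a b where K: "K = {a..b}" using tagged_division_interval[OF assms(1,2)] .
  obtain c d where L: "L = {c..d}" using tagged_division_interval[OF assms(3,4)] .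
  have KL: "K \<inter> L = {max a c..min b d}" using K L by auto
  with assms(5) have le: "max a c \<le> min b d" by auto
  show "{Inf (K \<inter> L)..Sup (K \<inter> L)} = K \<inter> L" "Inf (K \<inter> L) \<le> Sup (K \<inter> L)"
    "measure lebesgue (K \<inter> L) = Sup (K \<inter> L) - Inf (K \<inter> L)"
    using le unfolding KL by simp_all
qed

text \<open>The index set of the common refinement. Disjoint pairs are left out because
  \<open>Inf\<close> and \<open>Sup\<close> of the empty set are not endpoints of it; pairs touching
  in one point remain, as degenerate intervals.\<close>

definition meets :: "(real \<times> real set) set \<Rightarrow> (real \<times> real set) set \<Rightarrow> ((real \<times> real set) \<times> (real \<times> real set)) set" where
  "meets p q = {(z, z'). z \<in> p \<and> z' \<in> q \<and> snd z \<inter> snd z' \<noteq> {}}"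

text \<open>Each intersection lies in the balls of both its tags, so the common refinement carries
  two subordinate tag systems. The first six conclusions are arranged to match premises of the two
  swap lemmas.\<close>

lemma meets_family:
  assumes p: "p tagged_division_of {0..1}" "gauge_balls \<delta> fine p"
    and q: "q tagged_division_of {0..1}" "gauge_balls \<delta> fine q"
  defines "l \<equiv> \<lambda>(z, z'). Inf (snd z \<inter> snd z')" and "u \<equiv> \<lambda>(z, z'). Sup (snd z \<inter> snd z')"
  shows "finite (meets p q)"
    and "\<And>i. i \<in> meets p q \<Longrightarrow> l i \<le> u i"
    and "\<And>i. i \<in> meets p q \<Longrightarrow> subordinate_tag \<delta> (l i) (u i) (fst (fst i))"
    and "\<And>i. i \<in> meets p q \<Longrightarrow> subordinate_tag \<delta> (l i) (u i) (fst (snd i))"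
    and "\<And>i j. i \<in> meets p q \<Longrightarrow> j \<in> meets p q \<Longrightarrow> i \<noteq> j \<Longrightarrow>
      interior {l i..u i} \<inter> interior {l j..u j} = {}"
    and "(\<Union>i\<in>meets p q. {l i..u i}) = {0..1}"
    and "\<And>i. i \<in> meets p q \<Longrightarrow> measure lebesgue (snd (fst i) \<inter> snd (snd i)) = u i - l i"
proof -
  have fin: "finite (p \<times> q)" using tagged_division_ofD(1)[OF p(1)] tagged_division_ofD(1)[OF q(1)] by simp
  show "finite (meets p q)" by (rule finite_subset[OF _ fin]) (auto simp: meets_def)
  have I: "{l i..u i} = snd (fst i) \<inter> snd (snd i)" "l i \<le> u i"
    "measure lebesgue (snd (fst i) \<inter> snd (snd i)) = u i - l i"
    "fst i \<in> p" "snd i \<in> q" if "i \<in> meets p q" for i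
  proof -
    obtain x K y L where i: "i = ((x, K), (y, L))" by (metis prod.collapse)
    with that have *: "(x, K) \<in> p" "(y, L) \<in> q" "K \<inter> L \<noteq> {}" by (auto simp: meets_def)
    note I = tagged_division_inter_interval[OF p(1) *(1) q(1) *(2,3)]
    show "{l i..u i} = snd (fst i) \<inter> snd (snd i)" "l i \<le> u i"
      "measure lebesgue (snd (fst i) \<inter> snd (snd i)) = u i - l i" "fst i \<in> p" "snd i \<in> q"
      using I * by (simp_all add: i l_def u_def)
  qed
  show "l i \<le> u i" if "i \<in> meets p q" for i by (rule I[OF that])
  show "measure lebesgue (snd (fst i) \<inter> snd (snd i)) = u i - l i" if "i \<in> meets p q" for i
    by (rule I[OF that])
  have lu: "l i \<in> snd (fst i) \<inter> snd (snd i)" "u i \<in> snd (fst i) \<inter> snd (snd i)" if "i \<in> meets p q" for i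
    unfolding I(1)[OF that, symmetric] using I(2)[OF that] by auto
  show "subordinate_tag \<delta> (l i) (u i) (fst (fst i))" if "i \<in> meets p q" for i
    using subordinate_tag_gauge_balls[OF p, of "fst (fst i)" "snd (fst i)" "l i" "u i"] I[OF that] lu[OF that] by simp
  show "subordinate_tag \<delta> (l i) (u i) (fst (snd i))" if "i \<in> meets p q" for i
    using subordinate_tag_gauge_balls[OF q, of "fst (snd i)" "snd (snd i)" "l i" "u i"] I[OF that] lu[OF that] by simp
  show "interior {l i..u i} \<inter> interior {l j..u j} = {}"
    if ij: "i \<in> meets p q" "j \<in> meets p q" "i \<noteq> j" for i j
  proof -
    \<comment> \<open>Two distinct pairs differ in at least one component, and the division that
      this component comes from is non-overlapping.\<close>
    have "interior (snd (fst i)) \<inter> interior (snd (fst j)) = {} \<or> interior (snd (snd i)) \<inter> interior (snd (snd j)) = {}"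
    proof (cases "fst i = fst j")
      case True
      then have "snd i \<noteq> snd j" using ij(3) by (metis prod.collapse)
      then show ?thesis
        using tagged_division_ofD(5)[OF q(1)] I(5)[OF ij(1)] I(5)[OF ij(2)] by (metis prod.collapse)
    next
      case False
      then show ?thesis
        using tagged_division_ofD(5)[OF p(1)] I(4)[OF ij(1)] I(4)[OF ij(2)] by (metis prod.collapse)
    qed
    then show ?thesis unfolding I(1)[OF ij(1)] I(1)[OF ij(2)] interior_Int by blast
  qed
  have "(\<Union>i\<in>meets p q. {l i..u i}) = (\<Union>i\<in>meets p q. snd (fst i) \<inter> snd (snd i))"
    by (intro SUP_cong refl I(1))
  also have "\<dots> = \<Union>{K. \<exists>x. (x, K) \<in> p} \<inter> \<Union>{K. \<exists>x. (x, K) \<in> q}"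
  proof (intro equalityI subsetI)
    fix r assume "r \<in> \<Union>{K. \<exists>x. (x, K) \<in> p} \<inter> \<Union>{K. \<exists>x. (x, K) \<in> q}"
    then obtain x K y L where "(x, K) \<in> p" "(y, L) \<in> q" "r \<in> K" "r \<in> L" by blast
    then have "((x, K), (y, L)) \<in> meets p q" "r \<in> K \<inter> L" by (auto simp: meets_def)
    then show "r \<in> (\<Union>i\<in>meets p q. snd (fst i) \<inter> snd (snd i))" by force
  next
    fix r assume "r \<in> (\<Union>i\<in>meets p q. snd (fst i) \<inter> snd (snd i))"
    then show "r \<in> \<Union>{K. \<exists>x. (x, K) \<in> p} \<inter> \<Union>{K. \<exists>x. (x, K) \<in> q}"
      by (auto simp: meets_def)
  qed
  also have "\<dots> = {0..1}"
    using tagged_division_ofD(6)[OF p(1)] tagged_division_ofD(6)[OF q(1)] by simp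
  finally show "(\<Union>i\<in>meets p q. {l i..u i}) = {0..1}" .
qed

section \<open>Sums weighted by the measure of the part inside \<open>E\<close>\<close>

lemma tagged_division_subset:
  fixes q :: "(real \<times> real set) set"
  assumes "q tagged_division_of S" "(y, L) \<in> q"
  shows "L \<subseteq> S" "L \<in> lmeasurable" "measure lborel L = measure lebesgue L"
proof -
  show "L \<subseteq> S" by (rule tagged_division_ofD(3)[OF assms])
  show "L \<in> lmeasurable" "measure lborel L = measure lebesgue L"
    using tagged_division_ofD(4)[OF assms] by (auto simp: measure_completion)
qed

lemma lmeasurable_if_subset_Icc:
  fixes F :: "real set"
  assumes "F \<in> sets lebesgue" "F \<subseteq> {a..b}"
  shows "F \<in> lmeasurable"
  using assms bounded_subset[OF bounded_closed_interval assms(2)] by (simp add: bounded_set_imp_lmeasurable)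

text \<open>Integrating the indicator of \<open>F\<close> reduces this to additivity of the integral
  over a tagged division, which already takes care of the shared endpoints.\<close>

lemma measure_tagged_division:
  fixes q :: "(real \<times> real set) set"
  assumes q: "q tagged_division_of {0..1}" and F: "F \<in> sets lebesgue" "F \<subseteq> {0..1}"
  shows "(\<Sum>(y, L)\<in>q. measure lebesgue (F \<inter> L)) = measure lebesgue F"
proof -
  have Fm: "F \<in> lmeasurable" by (rule lmeasurable_if_subset_Icc[OF F])
  have int: "integral L (indicat_real F) = measure lebesgue (F \<inter> L)" if "L \<in> lmeasurable" for L
    using Fm that by (simp add: integral_indicator fmeasurable.Int Int_commute)
  have "indicat_real F integrable_on {0..1}"
    using Fm F(2) by (simp add: integrable_on_indicator inf.absorb1)
  then have "integral {0..1} (indicat_real F) = (\<Sum>(y, L)\<in>q. integral L (indicat_real F))"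
    using integral_combine_tagged_division_topdown[of "indicat_real F" 0 1 q] q by simp
  also have "\<dots> = (\<Sum>(y, L)\<in>q. measure lebesgue (F \<inter> L))"
    using int tagged_division_subset(2)[OF q] by (intro sum.cong) auto
  finally show ?thesis using int[of "{0..1}"] F(2) by (simp add: inf.absorb1)
qed

text \<open>An approximation to the Pettis integral over \<open>E\<close>. The set enters only
  through the weights: a tag may lie outside \<open>E\<close>, and \<phi> itself is not cut
  off.\<close>

definition restricted_sum :: "real set \<Rightarrow> (real \<Rightarrow> 'a::real_vector) \<Rightarrow> (real \<times> real set) set \<Rightarrow> 'a" where
  "restricted_sum E \<phi> p = (\<Sum>(x, K)\<in>p. measure lebesgue (K \<inter> E) *\<^sub>R \<phi> x)"

text \<open>By additivity of measure the weight of an interval of one division is distributed over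
  the intervals of the other. Both sums then run over one index set with the same weights and can be
  subtracted termwise.\<close>

lemma restricted_sum_eq_meets:
  fixes \<phi> :: "real \<Rightarrow> 'a::real_vector"
  assumes p: "p tagged_division_of {0..1}" and q: "q tagged_division_of {0..1}"
    and E: "E \<in> sets lebesgue" "E \<subseteq> {0..1}"
  defines "m \<equiv> \<lambda>i. measure lebesgue (snd (fst i) \<inter> snd (snd i) \<inter> E)"
  shows "restricted_sum E \<phi> p = (\<Sum>i\<in>meets p q. m i *\<^sub>R \<phi> (fst (fst i)))"
    and "restricted_sum E \<phi> q = (\<Sum>i\<in>meets p q. m i *\<^sub>R \<phi> (fst (snd i)))"
proof -
  have fin: "finite p" "finite q" using p q by (auto dest: tagged_division_ofD(1))
  have grid: "(\<Sum>i\<in>meets p q. m i *\<^sub>R h i) = (\<Sum>z\<in>p. \<Sum>z'\<in>q. m (z, z') *\<^sub>R h (z, z'))"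
    for h :: "(real \<times> real set) \<times> (real \<times> real set) \<Rightarrow> 'a"
  proof -
    \<comment> \<open>Pairs outside \<open>meets p q\<close> have empty intersection, hence weight
      0.\<close>
    have "(\<Sum>i\<in>meets p q. m i *\<^sub>R h i) = (\<Sum>i\<in>p \<times> q. m i *\<^sub>R h i)"
      using fin by (intro sum.mono_neutral_left) (auto simp: meets_def m_def)
    then show ?thesis by (simp add: sum.cartesian_product')
  qed
  have row: "(\<Sum>z'\<in>q'. measure lebesgue (K \<inter> snd z' \<inter> E)) = measure lebesgue (K \<inter> E)"
    if "q' tagged_division_of {0..1}" "p' tagged_division_of {0..1}" "(x, K) \<in> p'" for x K p' q'
  proof -
    have "K \<inter> E \<in> sets lebesgue" "K \<inter> E \<subseteq> {0..1}"
      using E tagged_division_subset(2)[OF that(2,3)] by auto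
    from measure_tagged_division[OF that(1) this] show ?thesis
      by (simp add: split_def Int_ac)
  qed
  show "restricted_sum E \<phi> p = (\<Sum>i\<in>meets p q. m i *\<^sub>R \<phi> (fst (fst i)))"
    unfolding grid restricted_sum_def using row[OF q p]
    by (intro sum.cong) (auto simp: m_def scaleR_left.sum[symmetric])
  have "(\<Sum>i\<in>meets p q. m i *\<^sub>R \<phi> (fst (snd i)))
      = (\<Sum>z'\<in>q. \<Sum>z\<in>p. m (z, z') *\<^sub>R \<phi> (fst z'))"
    unfolding grid by (subst sum.swap) simp
  also have "\<dots> = restricted_sum E \<phi> q"
    unfolding restricted_sum_def using row[OF p q]
    by (intro sum.cong) (auto simp: m_def scaleR_left.sum[symmetric] Int_ac)
  finally show "restricted_sum E \<phi> q = (\<Sum>i\<in>meets p q. m i *\<^sub>R \<phi> (fst (snd i)))" ..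
qed

text \<open>On the common refinement the difference is a tag swap with \<open>c i\<close> the
  measure of the part of the piece inside \<open>E\<close>, which is at most the length of the
  piece. The bound is uniform in \<open>E\<close>.\<close>

lemma restricted_sum_diff_le:
  assumes appr: "mcshane_approx \<delta> \<epsilon> \<phi> w"
    and p: "p tagged_division_of {0..1}" "gauge_balls \<delta> fine p"
    and q: "q tagged_division_of {0..1}" "gauge_balls \<delta> fine q"
    and E: "E \<in> sets lebesgue" "E \<subseteq> {0..1}"
  shows "norm (restricted_sum E \<phi> p - restricted_sum E \<phi> q) \<le> 2 * \<epsilon>"
proof -
  note fam = meets_family[OF p q]
  let ?m = "\<lambda>i. measure lebesgue (snd (fst i) \<inter> snd (snd i) \<inter> E)"
  have "norm (\<Sum>i\<in>meets p q. ?m i *\<^sub>R (\<phi> (fst (fst i)) - \<phi> (fst (snd i)))) \<le> 2 * \<epsilon>"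
  proof (rule mcshane_approx_swap[OF appr fam(1-6)])
    fix i assume i: "i \<in> meets p q"
    then have "snd (fst i) \<inter> snd (snd i) \<in> lmeasurable"
      using tagged_division_subset(2)[OF p(1)] tagged_division_subset(2)[OF q(1)]
      by (cases i) (auto simp: meets_def intro!: fmeasurable.Int)
    then have "?m i \<le> measure lebesgue (snd (fst i) \<inter> snd (snd i))"
      using E(1) by (intro measure_mono_fmeasurable) (auto simp: fmeasurableD)
    with fam(7)[OF i] show "0 \<le> ?m i \<and> ?m i \<le>
        (case i of (z, z') \<Rightarrow> Sup (snd z \<inter> snd z')) - (case i of (z, z') \<Rightarrow> Inf (snd z \<inter> snd z'))"
      by simp
  qed
  then show ?thesis
    unfolding restricted_sum_eq_meets[OF p(1) q(1) E]
    by (simp add: sum_subtractf[symmetric] scaleR_diff_right)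
qed

text \<open>The reverse triangle inequality in each term leads to
  \<open>mcshane_approx_swap_abs\<close>, the weights being the full lengths because every piece
  lies in the unit interval.\<close>

lemma restricted_sum_abs_diff_le:
  fixes g :: "real \<Rightarrow> real"
  assumes appr: "mcshane_approx \<delta> \<epsilon> g w"
    and p: "p tagged_division_of {0..1}" "gauge_balls \<delta> fine p"
    and q: "q tagged_division_of {0..1}" "gauge_balls \<delta> fine q"
  shows "\<bar>restricted_sum {0..1} (\<lambda>x. \<bar>g x\<bar>) p - restricted_sum {0..1} (\<lambda>x. \<bar>g x\<bar>) q\<bar> \<le> 4 * \<epsilon>"
proof -
  note fam = meets_family[OF p q]
  let ?m = "\<lambda>i. measure lebesgue (snd (fst i) \<inter> snd (snd i) \<inter> {0..1})"
  have m: "?m i = (case i of (z, z') \<Rightarrow> Sup (snd z \<inter> snd z')) - (case i of (z, z') \<Rightarrow> Inf (snd z \<inter> snd z'))"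
    if "i \<in> meets p q" for i
  proof -
    have "snd (fst i) \<inter> snd (snd i) \<inter> {0..1} = snd (fst i) \<inter> snd (snd i)"
    proof -
      have "(fst (fst i), snd (fst i)) \<in> p" using that by (auto simp: meets_def)
      from tagged_division_subset(1)[OF p(1) this] show ?thesis by blast
    qed
    with fam(7)[OF that] show ?thesis by simp
  qed
  have "\<bar>restricted_sum {0..1} (\<lambda>x. \<bar>g x\<bar>) p - restricted_sum {0..1} (\<lambda>x. \<bar>g x\<bar>) q\<bar>
      = \<bar>\<Sum>i\<in>meets p q. ?m i * (\<bar>g (fst (fst i))\<bar> - \<bar>g (fst (snd i))\<bar>)\<bar>"
    using restricted_sum_eq_meets[OF p(1) q(1), of "{0..1}" "\<lambda>x. \<bar>g x\<bar>"]
    by (simp add: sum_subtractf[symmetric] right_diff_distrib)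
  also have "\<dots> \<le> (\<Sum>i\<in>meets p q. ?m i * \<bar>g (fst (fst i)) - g (fst (snd i))\<bar>)"
    by (rule order_trans[OF sum_abs sum_mono]) (auto simp: abs_mult intro!: mult_left_mono)
  also have "\<dots> = (\<Sum>i\<in>meets p q. ((case i of (z, z') \<Rightarrow> Sup (snd z \<inter> snd z')) -
      (case i of (z, z') \<Rightarrow> Inf (snd z \<inter> snd z'))) * \<bar>g (fst (fst i)) - g (fst (snd i))\<bar>)"
    using m by (intro sum.cong) auto
  also have "\<dots> \<le> 4 * \<epsilon>"
    by (rule mcshane_approx_swap_abs[OF appr fam(1-6)])
  finally show ?thesis .
qed

section \<open>Absolute integrability of real McShane integrable functions\<close>

lemma restricted_sum_unit_interval:
  fixes p :: "(real \<times> real set) set"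
  assumes p: "p tagged_division_of {0..1}"
  shows "restricted_sum {0..1} \<phi> p = (\<Sum>(x, K)\<in>p. measure lborel K *\<^sub>R \<phi> x)"
  unfolding restricted_sum_def
  using tagged_division_subset[OF p] by (intro sum.cong) (auto simp: Int_absorb2)

text \<open>The Cauchy criterion for the Henstock--Kurzweil integral, specialised to gauges of the
  form \<open>gauge_balls \<delta>\<close>. It is applied to a function and to its absolute
  value.\<close>

lemma integrable_on_if_restricted_sum_Cauchy:
  fixes g :: "real \<Rightarrow> real"
  assumes "\<And>e. 0 < e \<Longrightarrow> \<exists>\<delta>. mcshane_gauge \<delta> \<and>
      (\<forall>p q. p tagged_division_of {0..1} \<and> gauge_balls \<delta> fine p \<and>
             q tagged_division_of {0..1} \<and> gauge_balls \<delta> fine q \<longrightarrow>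
             \<bar>restricted_sum {0..1} g p - restricted_sum {0..1} g q\<bar> < e)"
  shows "g integrable_on {0..1}"
proof -
  have "g integrable_on cbox 0 1"
    unfolding integrable_Cauchy
  proof (intro allI impI)
    fix e :: real assume "0 < e"
    with assms obtain \<delta> where "mcshane_gauge \<delta>"
      and *: "\<And>p q. p tagged_division_of {0..1} \<Longrightarrow> gauge_balls \<delta> fine p \<Longrightarrow>
             q tagged_division_of {0..1} \<Longrightarrow> gauge_balls \<delta> fine q \<Longrightarrow>
             \<bar>restricted_sum {0..1} g p - restricted_sum {0..1} g q\<bar> < e"
      by meson
    show "\<exists>\<gamma>. gauge \<gamma> \<and> (\<forall>\<D>1 \<D>2. \<D>1 tagged_division_of cbox 0 1 \<and> \<gamma> fine \<D>1 \<and>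
        \<D>2 tagged_division_of cbox 0 1 \<and> \<gamma> fine \<D>2 \<longrightarrow>
        norm ((\<Sum>(x, K)\<in>\<D>1. measure lborel K *\<^sub>R g x) - (\<Sum>(x, K)\<in>\<D>2. measure lborel K *\<^sub>R g x)) < e)"
    proof (intro exI[of _ "gauge_balls \<delta>"] conjI allI impI)
      show "gauge (gauge_balls \<delta>)" by (rule gauge_gauge_balls) fact
    next
      fix p q
      assume "p tagged_division_of cbox 0 1 \<and> gauge_balls \<delta> fine p \<and>
        q tagged_division_of cbox 0 1 \<and> gauge_balls \<delta> fine q"
      then show "norm ((\<Sum>(x, K)\<in>p. measure lborel K *\<^sub>R g x) - (\<Sum>(x, K)\<in>q. measure lborel K *\<^sub>R g x)) < e"
        using *[of p q] restricted_sum_unit_interval[of p g] restricted_sum_unit_interval[of q g] by simp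
    qed
  qed
  then show ?thesis by simp
qed

lemma has_mcshane_integral_absolutely_integrable:
  fixes g :: "real \<Rightarrow> real"
  assumes "has_mcshane_integral g w"
  shows "g absolutely_integrable_on {0..1}"
proof -
  \<comment> \<open>With error \<open>e / 5\<close> the bounds of two and four errors below both
    stay strictly under \<open>e\<close>.\<close>
  have appr: "\<exists>\<delta>. mcshane_gauge \<delta> \<and> mcshane_approx \<delta> (e / 5) g w" if "0 < e" for e :: real
    using has_mcshane_integralE[OF assms, of "e / 5"] that by fastforce
  have E: "{0..1::real} \<in> sets lebesgue" by simp
  have "g integrable_on {0..1}"
  proof (rule integrable_on_if_restricted_sum_Cauchy)
    fix e :: real assume e: "0 < e"
    then obtain \<delta> where \<delta>: "mcshane_gauge \<delta>" "mcshane_approx \<delta> (e / 5) g w" using appr by blast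
    have "\<bar>restricted_sum {0..1} g p - restricted_sum {0..1} g q\<bar> < e"
      if "p tagged_division_of {0..1}" "gauge_balls \<delta> fine p"
        "q tagged_division_of {0..1}" "gauge_balls \<delta> fine q" for p q
      using restricted_sum_diff_le[OF \<delta>(2) that E] e by simp
    with \<delta>(1) show "\<exists>\<delta>. mcshane_gauge \<delta> \<and> (\<forall>p q. p tagged_division_of {0..1} \<and> gauge_balls \<delta> fine p \<and>
        q tagged_division_of {0..1} \<and> gauge_balls \<delta> fine q \<longrightarrow>
        \<bar>restricted_sum {0..1} g p - restricted_sum {0..1} g q\<bar> < e)" by blast
  qed
  moreover have "(\<lambda>x. \<bar>g x\<bar>) integrable_on {0..1}"
  proof (rule integrable_on_if_restricted_sum_Cauchy)
    fix e :: real assume e: "0 < e"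
    then obtain \<delta> where \<delta>: "mcshane_gauge \<delta>" "mcshane_approx \<delta> (e / 5) g w" using appr by blast
    have "\<bar>restricted_sum {0..1} (\<lambda>x. \<bar>g x\<bar>) p - restricted_sum {0..1} (\<lambda>x. \<bar>g x\<bar>) q\<bar> < e"
      if "p tagged_division_of {0..1}" "gauge_balls \<delta> fine p"
        "q tagged_division_of {0..1}" "gauge_balls \<delta> fine q" for p q
      using restricted_sum_abs_diff_le[OF \<delta>(2) that] e by simp
    with \<delta>(1) show "\<exists>\<delta>. mcshane_gauge \<delta> \<and> (\<forall>p q. p tagged_division_of {0..1} \<and> gauge_balls \<delta> fine p \<and>
        q tagged_division_of {0..1} \<and> gauge_balls \<delta> fine q \<longrightarrow>
        \<bar>restricted_sum {0..1} (\<lambda>x. \<bar>g x\<bar>) p - restricted_sum {0..1} (\<lambda>x. \<bar>g x\<bar>) q\<bar> < e)" by blast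
  qed
  ultimately show ?thesis by (simp add: absolutely_integrable_on_def)
qed

section \<open>Comparison of the weighted sums with integrals over \<open>E\<close>\<close>

lemma absolutely_integrable_diff_const:
  fixes g :: "real \<Rightarrow> real"
  assumes g: "g absolutely_integrable_on {a..b}" and F: "F \<in> sets lebesgue" "F \<subseteq> {a..b}"
  shows "(\<lambda>y. g y - c) absolutely_integrable_on F"
proof (rule set_integral_diff(1))
  show "g absolutely_integrable_on F"
    by (rule set_integrable_subset[OF g F])
  show "(\<lambda>y. c) absolutely_integrable_on F"
    using lmeasurable_if_subset_Icc[OF F] by (rule absolutely_integrable_on_const)
qed

text \<open>Replace each integral by a Riemann sum over a fine division of \<open>K\<close>. These
  divisions together divide the unit interval, and each piece admits both its own tag and the tag of
  the \<open>K\<close> around it, so \<open>mcshane_approx_swap_abs\<close> bounds the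
  total.\<close>

lemma sum_integral_abs_diff_le:
  fixes g :: "real \<Rightarrow> real"
  assumes g: "g absolutely_integrable_on {0..1}"
    and \<delta>: "mcshane_gauge \<delta>" and appr: "mcshane_approx \<delta> \<epsilon> g w"
    and p: "p tagged_division_of {0..1}" "gauge_balls \<delta> fine p"
  shows "(\<Sum>(x, K)\<in>p. integral K (\<lambda>y. \<bar>g y - g x\<bar>)) \<le> 4 * \<epsilon>"
proof (rule field_le_epsilon)
  fix e :: real assume e: "0 < e"
  \<comment> \<open>One error \<eta> is spent per element of \<open>p\<close>; the summand 1 makes
    the denominator positive without a case distinction.\<close>
  define \<eta> where "\<eta> = e / (real (card p) + 1)"
  have \<eta>: "0 < \<eta>" "real (card p) * \<eta> \<le> e" using e by (auto simp: \<eta>_def field_simps)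
  have fin: "finite p" by (rule tagged_division_ofD(1)[OF p(1)])
  have "\<exists>D. D tagged_division_of (snd z) \<and> gauge_balls \<delta> fine D \<and>
      integral (snd z) (\<lambda>y. \<bar>g y - g (fst z)\<bar>)
        \<le> (\<Sum>(y, L)\<in>D. measure lborel L * \<bar>g y - g (fst z)\<bar>) + \<eta>" if z: "z \<in> p" for z
  proof -
    have zp: "(fst z, snd z) \<in> p" using z by simp
    obtain a b where K: "snd z = {a..b}" using tagged_division_interval[OF p(1) zp] .
    have "(\<lambda>y. g y - g (fst z)) absolutely_integrable_on {a..b}"
      using tagged_division_subset(1)[OF p(1) zp] K by (intro absolutely_integrable_diff_const[OF g]) auto
    then have "(\<lambda>y. \<bar>g y - g (fst z)\<bar>) integrable_on cbox a b"
      by (simp add: absolutely_integrable_on_def)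
    then have "((\<lambda>y. \<bar>g y - g (fst z)\<bar>) has_integral integral {a..b} (\<lambda>y. \<bar>g y - g (fst z)\<bar>)) (cbox a b)"
      by (simp add: integrable_integral)
    then obtain \<gamma> where \<gamma>: "gauge \<gamma>"
      and *: "\<And>D. D tagged_division_of cbox a b \<Longrightarrow> \<gamma> fine D \<Longrightarrow>
        norm ((\<Sum>(y, L)\<in>D. measure lborel L *\<^sub>R \<bar>g y - g (fst z)\<bar>)
          - integral {a..b} (\<lambda>y. \<bar>g y - g (fst z)\<bar>)) < \<eta>"
      unfolding has_integral using \<eta>(1) by meson
    \<comment> \<open>The intersected gauge serves two ends: \<gamma> makes the Riemann sum close to
      the integral, and \<open>gauge_balls \<delta>\<close> makes the new tags subordinate.\<close>
    obtain D where D: "D tagged_division_of {a..b}" "(\<lambda>x. \<gamma> x \<inter> gauge_balls \<delta> x) fine D"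
      using fine_division_exists_real[OF gauge_Int[OF \<gamma> gauge_gauge_balls[OF \<delta>]]] .
    then have "\<gamma> fine D" "gauge_balls \<delta> fine D" by (auto simp: fine_Int)
    with *[of D] D(1) show ?thesis
      unfolding K by (intro exI[of _ D]) (auto simp: abs_if split: if_splits)
  qed
  then obtain D where D: "\<And>z. z \<in> p \<Longrightarrow> D z tagged_division_of (snd z)"
      "\<And>z. z \<in> p \<Longrightarrow> gauge_balls \<delta> fine D z"
      "\<And>z. z \<in> p \<Longrightarrow> integral (snd z) (\<lambda>y. \<bar>g y - g (fst z)\<bar>)
        \<le> (\<Sum>(y, L)\<in>D z. measure lborel L * \<bar>g y - g (fst z)\<bar>) + \<eta>"
    by metis
  \<comment> \<open>An index is a pair of some \<open>(x, K)\<close> in \<open>p\<close> and some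
    \<open>(y, L)\<close> in its division; the interval is \<open>L\<close>, and the competing tags
    are \<open>y\<close> and \<open>x\<close>.\<close>
  define l where "l = (\<lambda>i :: (real \<times> real set) \<times> (real \<times> real set). Inf (snd (snd i)))"
  define u where "u = (\<lambda>i :: (real \<times> real set) \<times> (real \<times> real set). Sup (snd (snd i)))"
  have I: "fst i \<in> p" "(fst (snd i), snd (snd i)) \<in> D (fst i)" "(fst (fst i), snd (fst i)) \<in> p"
    "snd (snd i) \<subseteq> snd (fst i)" "snd (fst i) \<subseteq> {0..1}"
    "{l i..u i} = snd (snd i)" "l i \<le> u i" "measure lborel (snd (snd i)) = u i - l i"
    if "i \<in> Sigma p D" for i
  proof -
    show 1: "fst i \<in> p" "(fst (snd i), snd (snd i)) \<in> D (fst i)" "(fst (fst i), snd (fst i)) \<in> p"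
      using that by auto
    show "snd (snd i) \<subseteq> snd (fst i)" "snd (fst i) \<subseteq> {0..1}"
      using tagged_division_subset(1)[OF D(1)[OF 1(1)] 1(2)] tagged_division_subset(1)[OF p(1) 1(3)] by auto
    obtain a b where "snd (snd i) = {a..b}" "a \<le> b"
      using tagged_division_interval[OF D(1)[OF 1(1)] 1(2)] .
    then show "{l i..u i} = snd (snd i)" "l i \<le> u i" "measure lborel (snd (snd i)) = u i - l i"
      by (simp_all add: l_def u_def)
  qed
  have finD: "finite (D z)" if "z \<in> p" for z using tagged_division_ofD(1)[OF D(1)[OF that]] .
  have "(\<Sum>(x, K)\<in>p. integral K (\<lambda>y. \<bar>g y - g x\<bar>))
      \<le> (\<Sum>z\<in>p. (\<Sum>(y, L)\<in>D z. measure lborel L * \<bar>g y - g (fst z)\<bar>) + \<eta>)"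
    using D(3) by (auto simp: split_def intro!: sum_mono)
  also have "\<dots> = (\<Sum>i\<in>Sigma p D. measure lborel (snd (snd i)) * \<bar>g (fst (snd i)) - g (fst (fst i))\<bar>)
      + real (card p) * \<eta>"
    using fin finD by (simp add: sum.distrib sum.Sigma split_def)
  also have "(\<Sum>i\<in>Sigma p D. measure lborel (snd (snd i)) * \<bar>g (fst (snd i)) - g (fst (fst i))\<bar>)
      = (\<Sum>i\<in>Sigma p D. (u i - l i) * \<bar>g (fst (snd i)) - g (fst (fst i))\<bar>)"
    by (rule sum.cong[OF refl]) (simp only: I(8))
  also have "\<dots> \<le> 4 * \<epsilon>"
  proof (rule mcshane_approx_swap_abs[OF appr])
    show "finite (Sigma p D)" using fin finD by blast
    show "l i \<le> u i" if "i \<in> Sigma p D" for i by (rule I(7)[OF that])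
    have lu: "l i \<in> snd (snd i)" "u i \<in> snd (snd i)" if "i \<in> Sigma p D" for i
      using I(6,7)[OF that] by (metis atLeastAtMost_iff order_refl)+
    show "subordinate_tag \<delta> (l i) (u i) (fst (snd i))" if "i \<in> Sigma p D" for i
      by (rule subordinate_tag_gauge_balls[OF D(1)[OF I(1)[OF that]] D(2)[OF I(1)[OF that]]
          I(2)[OF that] lu[OF that] I(5)[OF that]])
    \<comment> \<open>The endpoints of the small interval are points of the interval of
      \<open>p\<close> around it, so the old tag is still subordinate.\<close>
    show "subordinate_tag \<delta> (l i) (u i) (fst (fst i))" if "i \<in> Sigma p D" for i
      using subordinate_tag_gauge_balls[OF p I(3)[OF that] _ _ order_refl] lu[OF that] I(4)[OF that] by blast
    show "interior {l i..u i} \<inter> interior {l j..u j} = {}"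
      if ij: "i \<in> Sigma p D" "j \<in> Sigma p D" "i \<noteq> j" for i j
    proof (cases "fst i = fst j")
      case True
      then have ne: "(fst (snd i), snd (snd i)) \<noteq> (fst (snd j), snd (snd j))"
        using ij(3) by (metis prod.collapse)
      have "(fst (snd j), snd (snd j)) \<in> D (fst i)" using I(2)[OF ij(2)] True by simp
      from tagged_division_ofD(5)[OF D(1)[OF I(1)[OF ij(1)]] I(2)[OF ij(1)] this ne]
      show ?thesis unfolding I(6)[OF ij(1)] I(6)[OF ij(2)] .
    next
      case False
      then have "(fst (fst i), snd (fst i)) \<noteq> (fst (fst j), snd (fst j))" by simp
      from tagged_division_ofD(5)[OF p(1) I(3)[OF ij(1)] I(3)[OF ij(2)] this]
      show ?thesis
        unfolding I(6)[OF ij(1)] I(6)[OF ij(2)]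
        using interior_mono[OF I(4)[OF ij(1)]] interior_mono[OF I(4)[OF ij(2)]] by blast
    qed
    have "(\<Union>i\<in>Sigma p D. {l i..u i}) = (\<Union>i\<in>Sigma p D. snd (snd i))"
      by (intro SUP_cong refl I(6))
    also have "\<dots> = (\<Union>z\<in>p. \<Union>z'\<in>D z. snd z')" by force
    also have "\<dots> = (\<Union>z\<in>p. \<Union>{L. \<exists>y. (y, L) \<in> D z})"
      by (intro SUP_cong refl) force
    also have "\<dots> = (\<Union>z\<in>p. snd z)"
      using tagged_division_ofD(6)[OF D(1)] by (intro SUP_cong refl)
    also have "\<dots> = \<Union>{K. \<exists>x. (x, K) \<in> p}" by force
    also have "\<dots> = {0..1}" by (rule tagged_division_ofD(6)[OF p(1)])
    finally show "(\<Union>i\<in>Sigma p D. {l i..u i}) = {0..1}" .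
  qed
  finally show "(\<Sum>(x, K)\<in>p. integral K (\<lambda>y. \<bar>g y - g x\<bar>)) \<le> 4 * \<epsilon> + e"
    using \<eta>(2) by simp
qed

text \<open>On each \<open>K\<close> the error is the integral of \<open>g - g x\<close> over the
  part of \<open>K\<close> inside \<open>E\<close>, at most the integral of its absolute value over
  all of \<open>K\<close>. Summing reduces to \<open>sum_integral_abs_diff_le\<close>, uniformly in
  \<open>E\<close>.\<close>

lemma integral_restricted_sum_le:
  fixes g :: "real \<Rightarrow> real"
  assumes g: "g absolutely_integrable_on {0..1}"
    and \<delta>: "mcshane_gauge \<delta>" and appr: "mcshane_approx \<delta> \<epsilon> g w"
    and p: "p tagged_division_of {0..1}" "gauge_balls \<delta> fine p"
    and E: "E \<in> sets lebesgue" "E \<subseteq> {0..1}"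
  shows "\<bar>integral E g - restricted_sum E g p\<bar> \<le> 4 * \<epsilon>"
proof -
  \<comment> \<open>Extension by zero outside \<open>E\<close>, so that the integral over
    \<open>E\<close> can be split along the division \<open>p\<close> of the unit interval.\<close>
  let ?h = "\<lambda>y. if y \<in> E then g y else 0"
  have "g absolutely_integrable_on E" by (rule set_integrable_subset[OF g E])
  then have "?h integrable_on {0..1}"
    using E(2) by (simp add: integrable_restrict_Int absolutely_integrable_on_def inf.absorb1)
  then have "integral {0..1} ?h = (\<Sum>(x, K)\<in>p. integral K ?h)"
    using integral_combine_tagged_division_topdown[of ?h 0 1 p] p(1) by simp
  then have split: "integral E g = (\<Sum>(x, K)\<in>p. integral (E \<inter> K) g)"
    using E(2) by (simp add: Henstock_Kurzweil_Integration.integral_restrict_Int inf.absorb1)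
  have each: "\<bar>integral (E \<inter> K) g - measure lebesgue (K \<inter> E) * g x\<bar> \<le> integral K (\<lambda>y. \<bar>g y - g x\<bar>)"
    if "(x, K) \<in> p" for x K
  proof -
    have K: "K \<in> sets lebesgue" "K \<subseteq> {0..1}" using tagged_division_subset(1,2)[OF p(1) that] by auto
    then have EK: "E \<inter> K \<in> sets lebesgue" "E \<inter> K \<subseteq> {0..1}" using E by auto
    have ai: "(\<lambda>y. g y - g x) absolutely_integrable_on F" if "F \<in> sets lebesgue" "F \<subseteq> {0..1}" for F
      by (rule absolutely_integrable_diff_const[OF g that])
    have lm: "E \<inter> K \<in> lmeasurable" by (rule lmeasurable_if_subset_Icc[OF EK])
    have "integral (E \<inter> K) (\<lambda>y. g y - g x) = integral (E \<inter> K) g - integral (E \<inter> K) (\<lambda>y. g x)"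
      using set_integrable_subset[OF g EK] integrable_on_const[OF lm]
      by (intro Henstock_Kurzweil_Integration.integral_diff) (auto simp: absolutely_integrable_on_def)
    also have "integral (E \<inter> K) (\<lambda>y. g x) = measure lebesgue (K \<inter> E) * g x"
      using lmeasure_integral[OF lm] integral_mult_left[of "E \<inter> K" "\<lambda>_. 1" "g x"]
      by (simp add: Int_commute)
    finally have "\<bar>integral (E \<inter> K) g - measure lebesgue (K \<inter> E) * g x\<bar>
        = norm (integral (E \<inter> K) (\<lambda>y. g y - g x))" by simp
    also have "\<dots> \<le> integral (E \<inter> K) (\<lambda>y. \<bar>g y - g x\<bar>)"
      using ai[OF EK] by (intro integral_norm_bound_integral) (auto simp: absolutely_integrable_on_def)
    also have "\<dots> \<le> integral K (\<lambda>y. \<bar>g y - g x\<bar>)"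
      using ai[OF EK] ai[OF K] by (intro integral_subset_le) (auto simp: absolutely_integrable_on_def)
    finally show ?thesis .
  qed
  have "\<bar>integral E g - restricted_sum E g p\<bar>
      = \<bar>\<Sum>(x, K)\<in>p. integral (E \<inter> K) g - measure lebesgue (K \<inter> E) * g x\<bar>"
    unfolding split restricted_sum_def by (simp add: sum_subtractf[symmetric] split_def)
  also have "\<dots> \<le> (\<Sum>(x, K)\<in>p. integral K (\<lambda>y. \<bar>g y - g x\<bar>))"
    using each by (intro order_trans[OF sum_abs sum_mono]) auto
  also have "\<dots> \<le> 4 * \<epsilon>"
    by (rule sum_integral_abs_diff_le[OF g \<delta> appr p])
  finally show ?thesis .
qed

section \<open>Functionals, and construction of the Pettis integral\<close>

lemma blinfun_restricted_sum:
  fixes f :: "'a::banach \<Rightarrow>\<^sub>L real"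
  shows "f (restricted_sum E \<phi> p) = restricted_sum E (\<lambda>x. f (\<phi> x)) p"
  unfolding restricted_sum_def by (simp add: blinfun.sum_right blinfun.scaleR_right split_def)

lemma has_mcshane_integral_blinfun:
  fixes f :: "'a::banach \<Rightarrow>\<^sub>L real"
  assumes "has_mcshane_integral \<phi> w"
  shows "has_mcshane_integral (\<lambda>x. f (\<phi> x)) (f w)"
  unfolding has_mcshane_integral_def mcshane_approx_def[symmetric]
proof (intro allI impI)
  fix e :: real assume e: "0 < e"
  \<comment> \<open>Dividing by \<open>norm f + 1\<close> covers the zero functional too.\<close>
  have N: "norm f + 1 > 0" using norm_ge_zero[of f] by linarith
  obtain \<delta> where \<delta>: "mcshane_gauge \<delta>" "mcshane_approx \<delta> (e / (norm f + 1)) \<phi> w"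
    using has_mcshane_integralE[OF assms divide_pos_pos[OF e N]] .
  have "norm f * (e / (norm f + 1)) \<le> e" using e N by (simp add: field_simps)
  then have "mcshane_approx \<delta> e (\<lambda>x. f (\<phi> x)) (f w)"
    using mcshane_approx_blinfun[OF \<delta>(2), of f] unfolding mcshane_approx_def by fastforce
  with \<delta>(1) show "\<exists>\<delta>. mcshane_gauge \<delta> \<and> mcshane_approx \<delta> e (\<lambda>x. f (\<phi> x)) (f w)" by blast
qed

theorem mainTheorem1:
  fixes \<phi> :: "real \<Rightarrow> 'a::banach"
  assumes "mcshane_integrable \<phi>"
  shows "pettis_integrable \<phi>"
  unfolding pettis_integrable_def
proof (intro ballI)
  fix E :: "real set" assume E': "E \<in> sets (lebesgue_on {0..1})"
  then have E: "E \<in> sets lebesgue" "E \<subseteq> {0..1}" by (auto simp: sets_restrict_space_iff)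
  obtain I where I: "has_mcshane_integral \<phi> I" using assms by (auto simp: mcshane_integrable_def)
  define r where "r = (\<lambda>n. inverse (real (Suc n)))"
  have "\<exists>\<delta>. mcshane_gauge \<delta> \<and> mcshane_approx \<delta> (r n) \<phi> I" for n
    using has_mcshane_integralE[OF I, of "r n"] by (fastforce simp: r_def)
  then obtain \<delta> where \<delta>: "\<And>n. mcshane_gauge (\<delta> n)" "\<And>n. mcshane_approx (\<delta> n) (r n) \<phi> I" by metis
  \<comment> \<open>Fineness is required for all gauges up to \<open>n\<close>, not only the last:
    then any two divisions with index at least \<open>N\<close> are fine for
    \<open>\<delta> N\<close> and can be compared there.\<close>
  have "\<exists>p. p tagged_division_of {0..1} \<and> (\<forall>k\<le>n. gauge_balls (\<delta> k) fine p)" for n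
  proof -
    have "gauge (\<lambda>x. \<Inter>k\<in>{..n}. gauge_balls (\<delta> k) x)"
      using gauge_gauge_balls[OF \<delta>(1)] unfolding gauge_def by (intro allI conjI open_INT) auto
    then obtain p where p: "p tagged_division_of {0..1}" "(\<lambda>x. \<Inter>k\<in>{..n}. gauge_balls (\<delta> k) x) fine p"
      by (rule fine_division_exists_real)
    have "gauge_balls (\<delta> k) fine p" if "k \<le> n" for k
      unfolding fine_def
    proof clarify
      fix x K y assume "(x, K) \<in> p" "y \<in> K"
      then have "y \<in> (\<Inter>k\<in>{..n}. gauge_balls (\<delta> k) x)" using p(2) unfolding fine_def by blast
      then show "y \<in> gauge_balls (\<delta> k) x" using that by simp
    qed
    with p(1) show ?thesis by blast
  qed
  then obtain p where p: "\<And>n. p n tagged_division_of {0..1}"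
    and fine: "\<And>k n. k \<le> n \<Longrightarrow> gauge_balls (\<delta> k) fine p n" by metis
  \<comment> \<open>These sums are formed in the Banach space itself, so their limit may depend on
    \<open>E\<close> but not on a functional.\<close>
  define S where "S = (\<lambda>n. restricted_sum E \<phi> (p n))"
  have r0: "r \<longlonglongrightarrow> 0" unfolding r_def by (rule LIMSEQ_inverse_real_of_nat)
  have "Cauchy S"
  proof (rule metric_CauchyI)
    fix e :: real assume "0 < e"
    then obtain N where N: "r N < e / 2"
      using order_tendstoD(2)[OF r0, of "e / 2"] by (auto simp: eventually_sequentially)
    show "\<exists>M. \<forall>m\<ge>M. \<forall>n\<ge>M. dist (S m) (S n) < e"
    proof (intro exI[of _ N] allI impI)
      fix m n assume "N \<le> m" "N \<le> n"
      then have "dist (S m) (S n) \<le> 2 * r N"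
        unfolding dist_norm S_def
        by (intro restricted_sum_diff_le[OF \<delta>(2) p fine p fine E])
      then show "dist (S m) (S n) < e" using N by simp
    qed
  qed
  then obtain w where w: "S \<longlonglongrightarrow> w" using Cauchy_convergent by (auto simp: convergent_def)
  show "\<exists>w. \<forall>f :: 'a \<Rightarrow>\<^sub>L real.
        set_integrable (lebesgue_on {0..1}) E (\<lambda>x. blinfun_apply f (\<phi> x)) \<and>
        (LINT x:E|lebesgue_on {0..1}. blinfun_apply f (\<phi> x)) = blinfun_apply f w"
  proof (intro exI[of _ w] allI)
    fix f :: "'a \<Rightarrow>\<^sub>L real"
    let ?g = "\<lambda>x. blinfun_apply f (\<phi> x)"
    have g: "?g absolutely_integrable_on {0..1}"
      by (rule has_mcshane_integral_absolutely_integrable[OF has_mcshane_integral_blinfun[OF I]])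
    have gE: "?g absolutely_integrable_on E" by (rule set_integrable_subset[OF g E])
    \<comment> \<open>As \<open>E\<close> lies in the unit interval, the extra indicator coming from
      the restricted measure space is absorbed.\<close>
    have ind: "(\<lambda>x. indicator {0..1} x * (indicator E x * ?g x)) = (\<lambda>x. indicator E x * ?g x)"
      using E(2) by (auto simp: indicator_def fun_eq_iff)
    have si: "set_integrable (lebesgue_on {0..1}) E ?g"
      using gE unfolding set_integrable_def by (subst integrable_restrict_space) (auto simp: ind)
    have "(LINT x:E|lebesgue_on {0..1}. ?g x) = (LINT x:E|lebesgue. ?g x)"
      unfolding set_lebesgue_integral_def by (subst integral_restrict_space) (auto simp: ind)
    also have "\<dots> = integral E ?g" by (rule set_lebesgue_integral_eq_integral(2)[OF gE])
    also have "\<dots> = f w"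
    proof (rule LIMSEQ_unique)
      show "(\<lambda>n. f (S n)) \<longlonglongrightarrow> f w" by (intro tendsto_intros w)
      \<comment> \<open>The gauge \<open>\<delta> n\<close> chosen for \<phi> works for the
        composition with error \<open>norm f * r n\<close>, and comparing sum and integral costs
        four such errors.\<close>
      have le: "norm (f (S n) - integral E ?g) \<le> 4 * (norm f * r n)" for n
        using integral_restricted_sum_le[OF g \<delta>(1) mcshane_approx_blinfun[OF \<delta>(2)] p fine[OF order_refl] E, of n]
        by (simp add: S_def blinfun_restricted_sum abs_minus_commute)
      have lim: "(\<lambda>n. 4 * (norm f * r n)) \<longlonglongrightarrow> 0"
        using tendsto_mult_left[OF tendsto_mult_left[OF r0]] by force
      have "(\<lambda>n. f (S n) - integral E ?g) \<longlonglongrightarrow> 0"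
        by (rule Lim_null_comparison[OF always_eventually[OF allI[OF le]] lim])
      then show "(\<lambda>n. f (S n)) \<longlonglongrightarrow> integral E ?g" by (simp add: LIM_zero_iff)
    qed
    finally show "set_integrable (lebesgue_on {0..1}) E ?g \<and> (LINT x:E|lebesgue_on {0..1}. ?g x) = f w"
      using si by simp
  qed
qed

end
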